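(* Let $(p_n)_{n\ge 0}$ be a sequence of positive real numbers with $P_n=p_0+p_1+\dots+p_n\to\infty$ as $n\to\infty$, let $u=(u_n)_{n\ge 0}$ be a sequence of positive real numbers, let $A=(a_{vj})_{v,j\ge 0}$ be an infinite matrix of complex numbers, and let $1\le k<\infty$. Define, for $m,n,j\ge 0$, $$b(m,n,j)=\begin{cases} a_{nj}, & m=0,\\[2pt] \dfrac{p_m}{P_mP_{m-1}}\displaystyle\sum_{v=1}^{m}P_{v-1}a_{n+v,j}, & m\ge 1.\end{cases}$$ Then $A\in(\ell_1,|f(\overline{N}_p^u)|_k)$ if and only if both of the following hold: (1) for each $j\ge 0$, the series $\sum_{m=0}^{\infty}u_m^{k-1}|b(m,n,j)|^k$ converges uniformly in $n$; (2) $\displaystyle\sup\left\{\sum_{m=0}^{\infty}u_m^{k-1}|b(m,n,j)|^k : n,j\in\mathbb{N}\right\}<\infty.$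
   Context: All sequences are sequences of complex numbers indexed by $0,1,2,\dots$, and $\mathbb{N}=\{0,1,2,\dots\}$. For a sequence $a=(a_v)_{v\ge 0}$ and $m,n\ge 0$ put $$F_{m,n}(a)=\begin{cases} a_n, & m=0,\\[2pt] \dfrac{p_m}{P_mP_{m-1}}\displaystyle\sum_{v=1}^{m}P_{v-1}a_{n+v}, & m\ge 1.\end{cases}$$ For $k\ge 1$, $|f(\overline{N}_p^u)|_k$ is the set of all complex sequences $a$ such that the series $\sum_{m=0}^{\infty}u_m^{k-1}|F_{m,n}(a)|^k$ converges uniformly in $n\ge 0$. Here a series of nonnegative terms $\sum_m c_{m,n}$ "converges uniformly in $n$" if it converges for every $n\ge 0$ and its tails $\sum_{m\ge M}c_{m,n}$ tend to $0$ as $M\to\infty$ uniformly in $n$. $\ell_1$ is the space of sequences $x$ with $\sum_v|x_v|<\infty$. For sets $X,Y$ of sequences, $A\in(X,Y)$ means that for every $x\in X$ the series $A_n(x)=\sum_{v=0}^{\infty}a_{nv}x_v$ converges for all $n\ge 0$ and the sequence $A(x)=(A_n(x))_{n\ge 0}$ belongs to $Y$. *)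

theory Defs
  imports "HOL-Analysis.Analysis"
begin

definition weight_sum :: "(nat \<Rightarrow> real) \<Rightarrow> nat \<Rightarrow> real" where
  "weight_sum p n = (\<Sum>i\<le>n. p i)"

definition riesz_F :: "(nat \<Rightarrow> real) \<Rightarrow> nat \<Rightarrow> nat \<Rightarrow> (nat \<Rightarrow> complex) \<Rightarrow> complex" where
  "riesz_F p m n a =
     (if m = 0 then a n
      else complex_of_real (p m / (weight_sum p m * weight_sum p (m - 1))) *
           (\<Sum>v = 1..m. complex_of_real (weight_sum p (v - 1)) * a (n + v)))"

text \<open>
  For nonnegative terms \<open>c m n\<close>: every series \<open>\<Sum>m. c m n\<close> converges, and the tails
  \<open>\<Sum>m. c (m + M) n\<close> (the sum over all indices from \<open>M\<close> on) tend to \<open>0\<close> uniformly in \<open>n\<close>.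
\<close>

definition series_converges_uniformly :: "(nat \<Rightarrow> nat \<Rightarrow> real) \<Rightarrow> bool" where
  "series_converges_uniformly c \<longleftrightarrow>
     (\<forall>n. summable (\<lambda>m. c m n)) \<and>
     uniform_limit UNIV (\<lambda>M n. \<Sum>m. c (m + M) n) (\<lambda>n. 0) sequentially"

definition almost_abs_riesz ::
    "(nat \<Rightarrow> real) \<Rightarrow> (nat \<Rightarrow> real) \<Rightarrow> real \<Rightarrow> (nat \<Rightarrow> complex) set" where
  "almost_abs_riesz p u k =
     {a. series_converges_uniformly
           (\<lambda>m n. u m powr (k - 1) * cmod (riesz_F p m n a) powr k)}"

definition ell1 :: "(nat \<Rightarrow> complex) set" where
  "ell1 = {x. summable (\<lambda>v. cmod (x v))}"

definition matrix_maps ::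
    "(nat \<Rightarrow> complex) set \<Rightarrow> (nat \<Rightarrow> complex) set \<Rightarrow> (nat \<Rightarrow> nat \<Rightarrow> complex) set" where
  "matrix_maps X Y =
     {A. \<forall>x\<in>X. (\<forall>n. summable (\<lambda>v. A n v * x v)) \<and> (\<lambda>n. \<Sum>v. A n v * x v) \<in> Y}"

definition riesz_b ::
    "(nat \<Rightarrow> real) \<Rightarrow> (nat \<Rightarrow> nat \<Rightarrow> complex) \<Rightarrow> nat \<Rightarrow> nat \<Rightarrow> nat \<Rightarrow> complex" where
  "riesz_b p A m n j =
     (if m = 0 then A n j
      else complex_of_real (p m / (weight_sum p m * weight_sum p (m - 1))) *
           (\<Sum>v = 1..m. complex_of_real (weight_sum p (v - 1)) * A (n + v) j))"

end

theory Submission imports Defs begin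

text \<open>
  Sufficiency: Jensen's inequality with weights \<open>|x\<^sub>j|\<close> bounds the tails for \<open>A x\<close> by a multiple of
  the average \<open>\<Sum>j. |x\<^sub>j| T\<^sub>j\<close> of the tails \<open>T\<^sub>j\<close> for the columns of \<open>A\<close>; these are uniformly bounded
  by (2), and by (1) finitely many of them are uniformly small.

  Necessity: applying \<open>A\<close> to the unit sequences gives (1). For (2), the partial sums of the series
  belonging to \<open>A x\<close> form a pointwise bounded family of \<open>k\<close>-homogeneous convex functionals on \<open>ell1\<close>,
  to which the uniform boundedness principle applies.
\<close>

section \<open>Convexity of powers and Jensen's inequality for weighted series\<close>

text \<open>The graph of the \<open>k\<close>-th power lies above its tangent at \<open>s\<close>.
  Young's inequality yields this without derivatives, and the cases \<open>k = 1\<close> and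
  \<open>s = 0\<close> are immediate.\<close>

lemma powr_tangent_le:
  fixes s t k :: real
  assumes "1 \<le> k" "0 \<le> s" "0 \<le> t"
  shows "s powr k + k * s powr (k - 1) * (t - s) \<le> t powr k"
proof (cases "k = 1 \<or> s = 0")
  case True
  then show ?thesis using assms by (auto simp: powr_one')
next
  case False
  \<comment> \<open>The exponent conjugate to \<open>k\<close>. In Young's inequality for
    \<open>t\<close> and \<open>s powr (k - 1)\<close>, the identity \<open>(k - 1) * q = k\<close>
    turns the second term into a multiple of \<open>s powr k\<close>.\<close>
  define q where "q = k / (k - 1)"
  have k: "k > 1" and s: "s > 0" using False assms by auto
  have q: "q > 1" "1 / k + 1 / q = 1" "(k - 1) * q = k" "k / q = k - 1"
    using k by (auto simp: q_def field_simps)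
  have "t * s powr (k - 1) \<le> t powr k / k + (s powr (k - 1)) powr q / q"
    using k q assms by (intro Youngs_inequality) auto
  then have "k * (t * s powr (k - 1)) \<le> k * (t powr k / k + s powr k / q)"
    using k by (simp add: powr_powr q)
  also have "\<dots> = t powr k + (k / q) * s powr k"
    using k by (simp add: field_simps)
  finally have 1: "k * (t * s powr (k - 1)) \<le> t powr k + (k - 1) * s powr k"
    by (simp only: q)
  have "s powr (k - 1) * s = s powr k"
    using s by (metis add.commute diff_add_cancel powr_add powr_one order_less_imp_le)
  then have "k * s powr (k - 1) * (t - s) = k * (t * s powr (k - 1)) - k * s powr k"
    by (metis mult.assoc mult.commute right_diff_distrib)
  moreover have "(k - 1) * s powr k = k * s powr k - s powr k"
    by (simp add: left_diff_distrib)
  ultimately show ?thesis using 1 by linarith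
qed

text \<open>Midpoint convexity: in the sum of the tangent inequalities at the mean \<open>s\<close>
  of the two norms, the linear terms cancel.\<close>

lemma norm_add_powr_le:
  fixes x y :: "'a::real_normed_vector"
  assumes "1 \<le> k"
  shows "norm (x + y) powr k \<le> 2 powr (k - 1) * (norm x powr k + norm y powr k)"
proof -
  define s where "s = (norm x + norm y) / 2"
  have s: "0 \<le> s" by (simp add: s_def)
  have "norm (x + y) powr k \<le> (2 * s) powr k"
    using assms by (intro powr_mono2) (use norm_triangle_ineq[of x y] in \<open>auto simp: s_def\<close>)
  also have "\<dots> = 2 powr (k - 1) * (2 * s powr k)"
    using s by (simp add: powr_mult powr_diff)
  also have "2 * s powr k \<le> norm x powr k + norm y powr k"
  proof -
    have "k * s powr (k - 1) * (norm x - s) + k * s powr (k - 1) * (norm y - s) = 0"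
      by (simp add: s_def flip: distrib_left)
    with powr_tangent_le[OF assms s norm_ge_zero[of x]]
      powr_tangent_le[OF assms s norm_ge_zero[of y]]
    show ?thesis by linarith
  qed
  finally show ?thesis by (simp add: mult_left_mono)
qed

lemma summable_mult_bounded:
  fixes b x :: "nat \<Rightarrow> 'a::real_normed_algebra"
  assumes "summable (\<lambda>j. norm (x j))" "\<And>j. norm (b j) \<le> K"
  shows "summable (\<lambda>j. norm (b j * x j))"
proof (rule summable_comparison_test')
  show "summable (\<lambda>j. K * norm (x j))" using assms by (intro summable_mult)
  show "norm (norm (b j * x j)) \<le> K * norm (x j)" for j
    using assms(2)[of j] norm_mult_ineq[of "b j" "x j"]
    by (smt (verit) mult_right_mono norm_ge_zero real_norm_def)
qed

lemma summable_mult_bounded_real: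
  fixes b :: "nat \<Rightarrow> real"
  assumes "summable (\<lambda>j. norm (x j))" "\<And>j. 0 \<le> b j" "\<And>j. b j \<le> K"
  shows "summable (\<lambda>j. norm (x j) * b j)"
proof -
  have "summable (\<lambda>j. norm (b j * norm (x j)))"
    using assms by (intro summable_mult_bounded[where K = K]) auto
  then show ?thesis using assms(2) by (simp add: mult.commute abs_mult)
qed

text \<open>Jensen's inequality with the weights \<open>norm (x j)\<close>, whose total need not be
  1; the factor with exponent \<open>k - 1\<close> makes up for the normalisation. The bound
  \<open>K\<close> serves to make the series converge.\<close>

lemma norm_suminf_mult_powr_le:
  fixes b x :: "nat \<Rightarrow> 'a::{real_normed_div_algebra, banach}"
  assumes k: "1 \<le> k" and x: "summable (\<lambda>j. norm (x j))" and b: "\<And>j. norm (b j) \<le> K"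
  shows "norm (\<Sum>j. b j * x j) powr k
     \<le> (\<Sum>j. norm (x j)) powr (k - 1) * (\<Sum>j. norm (x j) * norm (b j) powr k)"
proof -
  define X where "X = (\<Sum>j. norm (x j))"
  define Y where "Y = (\<Sum>j. norm (x j) * norm (b j))"
  have nm: "norm (b j * x j) = norm (x j) * norm (b j)" for j
    by (simp add: norm_mult)
  have sb: "summable (\<lambda>j. norm (x j) * norm (b j))"
    using summable_mult_bounded[where b = b, OF x b] by (simp only: nm)
  have sbk: "summable (\<lambda>j. norm (x j) * norm (b j) powr k)"
    by (rule summable_mult_bounded_real[OF x, where K = "K powr k"])
      (use k in \<open>auto intro!: powr_mono2 b\<close>)
  have X0: "0 \<le> X" unfolding X_def using x by (intro suminf_nonneg) auto
  have Y0: "0 \<le> Y" unfolding Y_def using sb by (intro suminf_nonneg) auto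
  have "norm (\<Sum>j. b j * x j) \<le> Y"
    unfolding Y_def using summable_norm[OF summable_mult_bounded[where b = b, OF x b]]
    by (simp only: nm)
  then have 1: "norm (\<Sum>j. b j * x j) powr k \<le> Y powr k"
    using k by (intro powr_mono2) auto
  show ?thesis
  proof (cases "X = 0")
    case True
    then have "x j = 0" for j
      using suminf_eq_zero_iff[OF x] by (simp add: X_def)
    then show ?thesis by simp
  next
    case False
    \<comment> \<open>The tangent is taken at the weighted mean of the \<open>norm (b j)\<close>.
      Summed against the weights, its linear part is \<open>d * (Y - s * X) = 0\<close>.\<close>
    define s where "s = Y / X"
    define d where "d = k * s powr (k - 1)"
    have Xpos: "X > 0" using X0 False by simp
    have s0: "0 \<le> s" using X0 Y0 by (simp add: s_def)
    have "X * (s powr k - d * s) + d * Y \<le> (\<Sum>j. norm (x j) * norm (b j) powr k)"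
    proof (rule sums_le)
      show "(\<lambda>j. norm (x j) * (s powr k - d * s) + d * (norm (x j) * norm (b j)))
          sums (X * (s powr k - d * s) + d * Y)"
        unfolding X_def Y_def using x sb
        by (intro sums_add sums_mult sums_mult2 summable_sums)
      show "(\<lambda>j. norm (x j) * norm (b j) powr k) sums (\<Sum>j. norm (x j) * norm (b j) powr k)"
        using sbk by (rule summable_sums)
      fix j
      have "norm (x j) * (s powr k + d * (norm (b j) - s)) \<le> norm (x j) * norm (b j) powr k"
        using powr_tangent_le[OF k s0] by (intro mult_left_mono) (auto simp: d_def)
      then show "norm (x j) * (s powr k - d * s) + d * (norm (x j) * norm (b j))
          \<le> norm (x j) * norm (b j) powr k"
        by (simp add: algebra_simps)
    qed
    also have "X * (s powr k - d * s) + d * Y = X * s powr k"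
      using Xpos by (simp add: s_def field_simps)
    finally have "X powr (k - 1) * (X * s powr k)
        \<le> X powr (k - 1) * (\<Sum>j. norm (x j) * norm (b j) powr k)"
      by (intro mult_left_mono) auto
    moreover have "X powr (k - 1) * (X * s powr k) = Y powr k"
      using Xpos Y0 by (simp add: s_def powr_diff powr_divide)
    ultimately show ?thesis using 1 unfolding X_def by linarith
  qed
qed

text \<open>Jensen's inequality for each \<open>m\<close>, followed by an exchange of the sum over
  \<open>D\<close> with the series. It bounds blocks of partial sums for \<open>A x\<close> by
  averages over the columns, in both directions of the theorem. The bound \<open>K m\<close> may
  vary with \<open>m\<close>.\<close>

lemma sum_norm_suminf_mult_powr_le:
  fixes b :: "'m \<Rightarrow> nat \<Rightarrow> 'a::{real_normed_div_algebra, banach}"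
  assumes k: "1 \<le> k" and x: "summable (\<lambda>j. norm (x j))"
    and b: "\<And>m j. m \<in> D \<Longrightarrow> norm (b m j) \<le> K m" and w: "\<And>m. m \<in> D \<Longrightarrow> 0 \<le> w m"
  shows "(\<Sum>m\<in>D. w m * norm (\<Sum>j. b m j * x j) powr k)
     \<le> (\<Sum>j. norm (x j)) powr (k - 1) * (\<Sum>j. norm (x j) * (\<Sum>m\<in>D. w m * norm (b m j) powr k))"
proof -
  let ?X = "\<Sum>j. norm (x j)"
  have s: "summable (\<lambda>j. norm (x j) * norm (b m j) powr k)" if "m \<in> D" for m
    using x k that by (intro summable_mult_bounded_real[where K = "K m powr k"])
      (auto intro!: powr_mono2 b)
  have "(\<Sum>m\<in>D. w m * norm (\<Sum>j. b m j * x j) powr k)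
     \<le> (\<Sum>m\<in>D. w m * (?X powr (k - 1) * (\<Sum>j. norm (x j) * norm (b m j) powr k)))"
    using k x b w by (intro sum_mono mult_left_mono norm_suminf_mult_powr_le) auto
  also have "\<dots> = ?X powr (k - 1) * (\<Sum>m\<in>D. \<Sum>j. w m * (norm (x j) * norm (b m j) powr k))"
    using s by (simp add: suminf_mult sum_distrib_left mult_ac)
  also have "(\<Sum>m\<in>D. \<Sum>j. w m * (norm (x j) * norm (b m j) powr k))
     = (\<Sum>j. \<Sum>m\<in>D. w m * (norm (x j) * norm (b m j) powr k))"
    using s by (intro suminf_sum[symmetric] summable_mult) auto
  finally show ?thesis by (simp add: sum_distrib_left mult_ac)
qed

section \<open>Unit sequences and uniform boundedness on \<open>ell1\<close>\<close>

definition unit_seq :: "nat \<Rightarrow> nat \<Rightarrow> complex" where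
  "unit_seq j i = of_bool (i = j)"

lemma unit_seq_in_ell1: "unit_seq j \<in> ell1"
  unfolding ell1_def unit_seq_def by (auto intro!: summable_finite[of "{j}"])

lemma suminf_mult_unit_seq: "(\<Sum>i. a i * unit_seq j i) = a j"
  by (subst suminf_finite[of "{j}"]) (auto simp: unit_seq_def)

lemma ell1_add:
  assumes "x \<in> ell1" "y \<in> ell1"
  shows "(\<lambda>j. x j + y j) \<in> ell1"
proof -
  have "summable (\<lambda>j. cmod (x j) + cmod (y j))"
    using assms by (intro summable_add) (auto simp: ell1_def)
  then have "summable (\<lambda>j. cmod (x j + y j))"
    by (rule summable_comparison_test') (simp add: norm_triangle_ineq)
  then show ?thesis by (simp add: ell1_def)
qed

lemma ell1_mult: "x \<in> ell1 \<Longrightarrow> (\<lambda>j. c * x j) \<in> ell1"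
  unfolding ell1_def by (auto simp: norm_mult intro!: summable_mult)

text \<open>The map \<open>J\<close> may repeat values, so several \<open>c l\<close> can land on
  one coordinate. Exchanging the sums still gives the norm bound, since each \<open>l\<close>
  contributes to a single coordinate.\<close>

lemma suminf_unit_seq_ell1:
  fixes J :: "nat \<Rightarrow> nat"
  assumes c: "summable (\<lambda>l. cmod (c l))"
  defines "y \<equiv> (\<lambda>j. \<Sum>l. c l * unit_seq (J l) j)"
  shows "y \<in> ell1" and "(\<Sum>j. cmod (y j)) \<le> (\<Sum>l. cmod (c l))"
proof -
  have s: "summable (\<lambda>l. cmod (c l * unit_seq (J l) j))" for j
    by (rule summable_comparison_test'[OF c]) (auto simp: unit_seq_def)
  have *: "(\<Sum>j<N. cmod (y j)) \<le> (\<Sum>l. cmod (c l))" for N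
  proof -
    have "(\<Sum>j<N. cmod (y j)) \<le> (\<Sum>j<N. \<Sum>l. cmod (c l * unit_seq (J l) j))"
      unfolding y_def by (intro sum_mono summable_norm s)
    also have "\<dots> = (\<Sum>l. \<Sum>j<N. cmod (c l * unit_seq (J l) j))"
      using s by (intro suminf_sum[symmetric])
    also have "\<dots> \<le> (\<Sum>l. cmod (c l))"
    proof (rule suminf_le)
      show "(\<Sum>j<N. cmod (c l * unit_seq (J l) j)) \<le> cmod (c l)" for l
      proof -
        have "(\<Sum>j<N. cmod (c l * unit_seq (J l) j)) = (\<Sum>j<N. if j = J l then cmod (c l) else 0)"
          by (intro sum.cong) (auto simp: unit_seq_def)
        then show ?thesis by simp
      qed
    qed (use s c in \<open>auto intro: summable_sum\<close>)
    finally show ?thesis .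
  qed
  have sy: "summable (\<lambda>j. cmod (y j))"
    by (rule bounded_imp_summable[where B = "\<Sum>l. cmod (c l)"])
      (use *[of "Suc _"] in \<open>auto simp: lessThan_Suc_atMost\<close>)
  then show "y \<in> ell1" by (simp add: ell1_def)
  show "(\<Sum>j. cmod (y j)) \<le> (\<Sum>l. cmod (c l))"
    using sy * by (rule suminf_le_const)
qed

text \<open>
  The proof follows Sokal's elementary argument for the uniform boundedness theorem: if the bounds
  of \<open>\<phi> (I n)\<close> grow fast enough, the increments \<open>\<plusminus>5\<^sup>-\<^sup>n unit_seq (J n)\<close>, with signs chosen
  to make \<open>\<phi> (I n)\<close> large, add up to a point where the family is unbounded. The functionals are
  \<open>k\<close>-th powers of seminorms in the application, so that Minkowski's inequality is not needed.
\<close>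

lemma ell1_uniform_boundedness:
  fixes \<phi> :: "'i \<Rightarrow> (nat \<Rightarrow> complex) \<Rightarrow> real"
  assumes k: "1 \<le> k"
    and nonneg: "\<And>i x. 0 \<le> \<phi> i x"
    and subadd: "\<And>i x y. x \<in> ell1 \<Longrightarrow> y \<in> ell1 \<Longrightarrow>
           \<phi> i (\<lambda>j. x j + y j) \<le> 2 powr (k - 1) * (\<phi> i x + \<phi> i y)"
    and hom: "\<And>i x c. x \<in> ell1 \<Longrightarrow> \<phi> i (\<lambda>j. c * x j) = cmod c powr k * \<phi> i x"
    and bound: "\<And>i x S. x \<in> ell1 \<Longrightarrow> (\<And>j. \<phi> i (unit_seq j) \<le> S) \<Longrightarrow>
           \<phi> i x \<le> S * (\<Sum>j. cmod (x j)) powr k"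
    and finite: "\<And>i. \<exists>S. \<forall>j. \<phi> i (unit_seq j) \<le> S"
    and pointwise: "\<And>x. x \<in> ell1 \<Longrightarrow> \<exists>C. \<forall>i. \<phi> i x \<le> C"
  shows "\<exists>C. \<forall>i j. \<phi> i (unit_seq j) \<le> C"
proof (rule ccontr)
  assume "\<not> ?thesis"
  then have unb: "\<exists>i j. C < \<phi> i (unit_seq j)" for C
    by (meson not_le)
  define r :: "nat \<Rightarrow> real" where "r n = (1 / 5) ^ n" for n
  have r: "0 < r n" for n by (simp add: r_def)
  \<comment> \<open>The threshold is chosen so that multiplying by \<open>(r n / 2) powr k\<close>,
    the factor left at the end, gives more than \<open>n\<close>. The supremum over \<open>j\<close>
    need not be attained, so an index within a factor 2 of it is taken.\<close>
  have "\<exists>i j. real n / (r n / 2) powr k < \<phi> i (unit_seq j)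
      \<and> (\<forall>j'. \<phi> i (unit_seq j') \<le> 2 * \<phi> i (unit_seq j))" for n
  proof -
    define B where "B = real n / (r n / 2) powr k"
    have B: "0 \<le> B" by (simp add: B_def)
    obtain i j where ij: "B < \<phi> i (unit_seq j)" using unb by blast
    define S where "S = (SUP j. \<phi> i (unit_seq j))"
    have bdd: "bdd_above (range (\<lambda>j. \<phi> i (unit_seq j)))"
      using finite[of i] unfolding bdd_above_def by blast
    have le: "\<phi> i (unit_seq j') \<le> S" for j'
      unfolding S_def using bdd by (intro cSUP_upper) auto
    \<comment> \<open>Here \<open>S\<close> is positive because it exceeds \<open>B\<close>, so
      \<open>S / 2 < S\<close>.\<close>
    have "max B (S / 2) < S" using le[of j] ij B by auto
    moreover have "(T < S) = (\<exists>j. T < \<phi> i (unit_seq j))" for T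
      unfolding S_def using bdd by (subst less_cSUP_iff) auto
    ultimately obtain j' where "max B (S / 2) < \<phi> i (unit_seq j')"
      by blast
    then have "B < \<phi> i (unit_seq j') \<and> (\<forall>j''. \<phi> i (unit_seq j'') \<le> 2 * \<phi> i (unit_seq j'))"
      using le by (smt (verit, best) field_sum_of_halves)
    then show ?thesis unfolding B_def by blast
  qed
  then obtain I J where I1: "\<And>n. real n / (r n / 2) powr k < \<phi> (I n) (unit_seq (J n))"
    and I2: "\<And>n j'. \<phi> (I n) (unit_seq j') \<le> 2 * \<phi> (I n) (unit_seq (J n))"
    by metis
  define pert where "pert s n x = (\<lambda>j. x j + s * of_real (r n) * unit_seq (J n) j)"
    for s :: complex and n and x :: "nat \<Rightarrow> complex"
  define sg :: "nat \<Rightarrow> (nat \<Rightarrow> complex) \<Rightarrow> complex" where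
    "sg n x = (if \<phi> (I n) (pert (-1) n x) \<le> \<phi> (I n) (pert 1 n x) then 1 else -1)" for n x
  define X where "X = rec_nat (\<lambda>_. 0) (\<lambda>n x. pert (sg n x) n x)"
  have X0: "X 0 = (\<lambda>_. 0)" and XS: "X (Suc n) = pert (sg n (X n)) n (X n)" for n
    by (simp_all add: X_def)
  define c where "c n = sg n (X n) * of_real (r n)" for n
  have cn: "cmod (c n) = r n" for n
    using r[of n] by (simp add: c_def norm_mult sg_def)
  have Xsum: "X n j = (\<Sum>l<n. c l * unit_seq (J l) j)" for n j
    by (induction n) (simp_all add: X0 XS pert_def c_def)
  have XS': "X n \<in> ell1" for n
  proof (induction n)
    case 0
    then show ?case by (simp add: X0 ell1_def)
  next
    case (Suc n)
    then show ?case
      unfolding XS pert_def by (intro ell1_add ell1_mult unit_seq_in_ell1)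
  qed
  have sr: "summable r" unfolding r_def by (simp add: summable_geometric)
  define x where "x j = (\<Sum>l. c l * unit_seq (J l) j)" for j
  define y where "y n j = (\<Sum>l. c (l + n) * unit_seq (J (l + n)) j)" for n j
  have x: "x \<in> ell1"
    unfolding x_def using sr by (intro suminf_unit_seq_ell1) (simp add: cn)
  have sr': "summable (\<lambda>l. cmod (c (l + n)))" for n
    using sr by (simp add: cn summable_iff_shift)
  have y: "y n \<in> ell1" for n
    unfolding y_def[abs_def] using sr' by (rule suminf_unit_seq_ell1)
  \<comment> \<open>All increments after the \<open>n\<close>-th together have norm at most a
    quarter of the \<open>n\<close>-th one, by the geometric series of ratio
    \<open>1 / 5\<close>.\<close>
  have ynorm: "(\<Sum>j. cmod (y (Suc n) j)) \<le> r n / 4" for n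
  proof -
    have "(\<Sum>j. cmod (y (Suc n) j)) \<le> (\<Sum>l. cmod (c (l + Suc n)))"
      unfolding y_def using sr' by (rule suminf_unit_seq_ell1)
    also have "\<dots> = (\<Sum>l. r (Suc n) * (1 / 5) ^ l)"
      by (simp add: cn r_def power_add mult_ac)
    also have "\<dots> = r n / 4"
      by (subst suminf_mult) (auto simp: suminf_geometric summable_geometric r_def)
    finally show ?thesis .
  qed
  have xy: "X n j = x j + (-1) * y n j" for n j
  proof -
    have "summable (\<lambda>l. cmod (c l * unit_seq (J l) j))"
      by (rule summable_comparison_test'[OF sr]) (auto simp: unit_seq_def cn norm_mult less_imp_le[OF r])
    then have "summable (\<lambda>l. c l * unit_seq (J l) j)" by (rule summable_norm_cancel)
    from suminf_split_initial_segment[OF this, of n] show ?thesis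
      by (simp add: x_def y_def Xsum)
  qed
  have large: "real n < \<phi> (I n) x" for n
  proof -
    define D where "D = \<phi> (I n) (unit_seq (J n))"
    define \<psi> where "\<psi> = \<phi> (I n)"
    have D0: "0 \<le> D" by (simp add: D_def nonneg)
    have pe: "pert s n (X n) \<in> ell1" for s
      unfolding pert_def by (intro ell1_add ell1_mult unit_seq_in_ell1 XS')
    \<comment> \<open>The two candidate perturbations differ by \<open>2 * r n\<close> times a unit
      sequence. By \<open>subadd\<close> and \<open>hom\<close>, the larger of their two values is
      therefore at least \<open>r n powr k * D\<close>.\<close>
    have eq: "(\<lambda>j. 2 * of_real (r n) * unit_seq (J n) j)
        = (\<lambda>j. pert 1 n (X n) j + (-1) * pert (-1) n (X n) j)"
      by (simp add: pert_def algebra_simps)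
    have "2 powr k * (r n powr k * D) = \<psi> (\<lambda>j. 2 * of_real (r n) * unit_seq (J n) j)"
      unfolding \<psi>_def D_def using r[of n]
      by (subst hom) (auto simp: unit_seq_in_ell1 norm_mult powr_mult)
    also have "\<dots> \<le> 2 powr (k - 1) * (\<psi> (pert 1 n (X n)) + \<psi> (\<lambda>j. (-1) * pert (-1) n (X n) j))"
      unfolding eq \<psi>_def by (intro subadd pe ell1_mult)
    also have "\<psi> (\<lambda>j. (-1) * pert (-1) n (X n) j) = \<psi> (pert (-1) n (X n))"
      unfolding \<psi>_def by (subst hom[OF pe]) simp
    also have "2 powr (k - 1) * (\<psi> (pert 1 n (X n)) + \<psi> (pert (-1) n (X n)))
        \<le> 2 powr (k - 1) * (2 * \<psi> (X (Suc n)))"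
      by (intro mult_left_mono) (auto simp: XS sg_def \<psi>_def)
    also have "\<dots> = 2 powr k * \<psi> (X (Suc n))" by (simp add: powr_diff)
    finally have 1: "r n powr k * D \<le> \<psi> (X (Suc n))" by simp
    have "\<psi> (X (Suc n)) \<le> 2 powr (k - 1) * (\<psi> x + \<psi> (\<lambda>j. (-1) * y (Suc n) j))"
      unfolding xy[abs_def] \<psi>_def by (intro subadd x y ell1_mult)
    also have "\<psi> (\<lambda>j. (-1) * y (Suc n) j) = \<psi> (y (Suc n))"
      unfolding \<psi>_def by (subst hom[OF y]) simp
    also have "\<psi> (y (Suc n)) \<le> (2 * D) * (\<Sum>j. cmod (y (Suc n) j)) powr k"
      unfolding \<psi>_def D_def by (intro bound y I2)
    also have "\<dots> \<le> (2 * D) * (r n / 4) powr k"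
      using D0 k ynorm y[of "Suc n"]
      by (intro mult_left_mono powr_mono2) (auto simp: ell1_def intro: suminf_nonneg)
    finally have 2: "\<psi> (X (Suc n)) \<le> 2 powr (k - 1) * (\<psi> x + (2 * D) * (r n / 4) powr k)"
      by (simp add: mult_left_mono)
    have p4: "(4::real) powr k = 2 powr k * 2 powr k"
      by (simp flip: powr_mult)
    \<comment> \<open>Passing from \<open>X (Suc n)\<close> to the limit \<open>x\<close> costs this
      much. As \<open>k\<close> is at least 1, it is at most half of the lower bound for
      \<open>X (Suc n)\<close> and can be absorbed.\<close>
    have "2 powr (k - 1) * ((2 * D) * (r n / 4) powr k) = r n powr k * D / 2 powr k"
      using r[of n] by (simp add: powr_divide powr_diff p4)
    also have "\<dots> \<le> r n powr k * D / 2"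
      using D0 powr_mono[of 1 k 2] k by (intro divide_left_mono) auto
    finally have "r n powr k * D \<le> 2 powr (k - 1) * \<psi> x + r n powr k * D / 2"
      using 1 2 by (simp add: distrib_left)
    then have "r n powr k * D \<le> 2 powr k * \<psi> x" by (simp add: powr_diff)
    then have 3: "(r n / 2) powr k * D \<le> \<psi> x"
      using r[of n] by (simp add: powr_divide field_simps)
    have "real n < (r n / 2) powr k * D"
      using I1[of n] r[of n] by (simp add: D_def divide_less_eq mult.commute)
    with 3 show ?thesis by (simp add: \<psi>_def)
  qed
  obtain C where C: "\<And>i. \<phi> i x \<le> C" using pointwise[OF x] by blast
  obtain n where "C < real n" using reals_Archimedean2 by blast
  with large[of n] C[of "I n"] show False by linarith
qed

section \<open>Riesz means of series and bounds for members of
  \<open>almost_abs_riesz\<close>\<close>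

text \<open>As \<open>riesz_F p m n\<close> is a finite linear combination of values of its
  argument, it can be applied term by term to the convergent series that define
  \<open>A x\<close>.\<close>

lemma riesz_F_suminf:
  assumes "\<And>n. summable (\<lambda>j. A n j * x j)"
  shows "(\<lambda>j. riesz_b p A m n j * x j) sums riesz_F p m n (\<lambda>n. \<Sum>j. A n j * x j)"
proof (cases "m = 0")
  case True
  then show ?thesis using assms by (simp add: riesz_b_def riesz_F_def summable_sums)
next
  case False
  define c where "c = complex_of_real (p m / (weight_sum p m * weight_sum p (m - 1)))"
  have "(\<lambda>j. c * (\<Sum>v = 1..m. of_real (weight_sum p (v - 1)) * (A (n + v) j * x j)))
      sums (c * (\<Sum>v = 1..m. of_real (weight_sum p (v - 1)) * (\<Sum>j. A (n + v) j * x j)))"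
    by (intro sums_mult sums_sum summable_sums assms)
  moreover have "c * (\<Sum>v = 1..m. of_real (weight_sum p (v - 1)) * (A (n + v) j * x j))
      = riesz_b p A m n j * x j" for j
    using False by (simp add: riesz_b_def c_def sum_distrib_right mult.assoc)
  ultimately show ?thesis using False by (simp add: riesz_F_def c_def)
qed

lemma powr_le_imp_le_powr_inverse:
  fixes t k :: real
  assumes "0 < k" "0 \<le> t" "t powr k \<le> B"
  shows "t \<le> B powr (1 / k)"
proof -
  have "t = (t powr k) powr (1 / k)" using assms by (simp add: powr_powr)
  also have "\<dots> \<le> B powr (1 / k)" using assms by (intro powr_mono2) auto
  finally show ?thesis .
qed

lemma weight_sum_pos:
  assumes "\<And>n. p n > 0"
  shows "weight_sum p n > 0"
  unfolding weight_sum_def using assms by (intro sum_pos) auto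

text \<open>
  Convergence of the tails bounds \<open>riesz_F p m n a\<close> in \<open>n\<close> only for large \<open>m\<close>. The sums occurring
  in \<open>riesz_F\<close> for \<open>m\<close> and \<open>m + 1\<close> differ by a multiple of \<open>a (n + m + 1)\<close>, so \<open>a\<close> is
  bounded, and this handles the remaining \<open>m\<close>.
\<close>

lemma almost_abs_riesz_partial_sums_bounded:
  assumes p: "\<And>n. p n > 0" and u: "\<And>n. u n > 0" and k: "1 \<le> k"
    and a: "a \<in> almost_abs_riesz p u k"
  shows "\<exists>C. \<forall>n M. (\<Sum>m<M. u m powr (k - 1) * cmod (riesz_F p m n a) powr k) \<le> C"
proof -
  define c where "c m n = u m powr (k - 1) * cmod (riesz_F p m n a) powr k" for m n
  have c0: "0 \<le> c m n" for m n by (simp add: c_def)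
  have sc: "\<And>n. summable (\<lambda>m. c m n)"
    and lim: "uniform_limit UNIV (\<lambda>M n. \<Sum>m. c (m + M) n) (\<lambda>n. 0) sequentially"
    using a unfolding almost_abs_riesz_def series_converges_uniformly_def c_def by auto
  obtain M where M: "\<And>n. (\<Sum>m. c (m + M) n) < 1"
  proof -
    have "\<forall>\<^sub>F M in sequentially. \<forall>n\<in>UNIV. dist (\<Sum>m. c (m + M) n) 0 < 1"
      using lim by (rule uniform_limitD) simp
    then obtain M where "\<forall>n\<in>UNIV. dist (\<Sum>m. c (m + M) n) 0 < 1"
      unfolding eventually_sequentially by blast
    then show ?thesis by (intro that[of M]) (auto simp: dist_real_def abs_less_iff)
  qed
  have c1: "c (m + M) n \<le> 1" for m n
  proof -
    have "c (m + M) n = (\<Sum>i\<in>{m}. c (i + M) n)" by simp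
    also have "\<dots> \<le> (\<Sum>i. c (i + M) n)"
      using summable_ignore_initial_segment[OF sc] by (intro sum_le_suminf) (auto simp: c0)
    finally show ?thesis using M[of n] by linarith
  qed
  define G where "G m n = (\<Sum>v = 1..m. complex_of_real (weight_sum p (v - 1)) * a (n + v))" for m n
  have F: "riesz_F p m n a = complex_of_real (p m / (weight_sum p m * weight_sum p (m - 1))) * G m n"
    if "m \<noteq> 0" for m n
    using that by (simp add: riesz_F_def G_def)
  have P: "weight_sum p n > 0" for n using p by (rule weight_sum_pos)
  \<comment> \<open>The restriction on \<open>m\<close> keeps \<open>m + M\<close> positive even
    when \<open>M = 0\<close>, so that \<open>F\<close> applies. Hence the indices
    \<open>1 + M\<close> and \<open>2 + M\<close> are compared below.\<close>
  have G: "bounded (range (G (m + M)))" if "m \<noteq> 0" for m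
  proof -
    define d where "d = p (m + M) / (weight_sum p (m + M) * weight_sum p (m + M - 1))"
    have d: "d > 0" using p P by (simp add: d_def)
    have "cmod (G (m + M) n) \<le> (1 / u (m + M) powr (k - 1)) powr (1 / k) / d" for n
    proof -
      have "cmod (riesz_F p (m + M) n a) powr k \<le> 1 / u (m + M) powr (k - 1)"
        using c1[of m n] u[of "m + M"] by (simp add: c_def field_simps)
      then have "cmod (riesz_F p (m + M) n a) \<le> (1 / u (m + M) powr (k - 1)) powr (1 / k)"
        using k by (intro powr_le_imp_le_powr_inverse) auto
      moreover have "riesz_F p (m + M) n a = of_real d * G (m + M) n"
        unfolding d_def using that by (intro F) simp
      ultimately show ?thesis using d by (simp add: norm_mult field_simps)
    qed
    then show ?thesis unfolding bounded_iff by blast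
  qed
  have "bounded (range (\<lambda>n. G (2 + M) n - G (1 + M) n))"
    by (intro bounded_minus_comp G) auto
  then obtain B where "\<And>n. cmod (G (2 + M) n - G (1 + M) n) \<le> B"
    unfolding bounded_iff by blast
  moreover have "G (2 + M) n - G (1 + M) n = of_real (weight_sum p (1 + M)) * a (n + (2 + M))" for n
    by (simp add: G_def)
  ultimately have "weight_sum p (1 + M) * cmod (a (n + (2 + M))) \<le> B" for n
    using P[of "1 + M"] by (metis abs_of_pos norm_mult norm_of_real)
  then have "cmod (a (n + (2 + M))) \<le> B / weight_sum p (1 + M)" for n
    using P by (metis pos_le_divide_eq mult.commute)
  then have "Bseq (\<lambda>n. a (n + (2 + M)))" by (rule BseqI')
  then have "Bseq a" by (rule Bseq_offset)
  then obtain K where K: "\<And>n. cmod (a n) \<le> K" unfolding Bseq_def by blast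
  define L where "L m = (if m = 0 then K else \<bar>p m / (weight_sum p m * weight_sum p (m - 1))\<bar>
      * (\<Sum>v = 1..m. weight_sum p (v - 1) * K))" for m
  have L: "cmod (riesz_F p m n a) \<le> L m" for m n
  proof (cases "m = 0")
    case True
    then show ?thesis by (simp add: riesz_F_def L_def K)
  next
    case False
    have "cmod (G m n) \<le> (\<Sum>v = 1..m. weight_sum p (v - 1) * K)"
      unfolding G_def using less_imp_le[OF P]
      by (intro sum_norm_le) (auto simp: norm_mult intro!: mult_mono K)
    then show ?thesis
      unfolding F[OF False] L_def if_not_P[OF False] norm_mult norm_of_real
      by (rule mult_left_mono) simp
  qed
  \<comment> \<open>The whole series is split at \<open>M\<close>: the bound on \<open>a\<close>
    controls the finitely many first terms through \<open>L\<close>, and the tail is below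
    1.\<close>
  have "(\<Sum>m<N. c m n) \<le> (\<Sum>m<M. u m powr (k - 1) * L m powr k) + 1" for n N
  proof -
    have "(\<Sum>m<N. c m n) \<le> (\<Sum>m. c m n)"
      using sc c0 by (intro sum_le_suminf) auto
    also have "\<dots> = (\<Sum>m. c (m + M) n) + (\<Sum>m<M. c m n)"
      using sc by (rule suminf_split_initial_segment)
    also have "(\<Sum>m<M. c m n) \<le> (\<Sum>m<M. u m powr (k - 1) * L m powr k)"
      unfolding c_def using k by (intro sum_mono mult_left_mono powr_mono2 L) auto
    finally show ?thesis using M[of n] by linarith
  qed
  then show ?thesis unfolding c_def by blast
qed

section \<open>Necessity of the two conditions\<close>

text \<open>The classical fact that the Koethe dual of \<open>ell1\<close> consists of bounded
  sequences. It follows from uniform boundedness with \<open>k = 1\<close> for the moduli of the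
  partial sums, which are pointwise bounded because they converge.\<close>

lemma matrix_rows_bounded:
  assumes "\<And>x. x \<in> ell1 \<Longrightarrow> summable (\<lambda>j. a j * x j)"
  shows "\<exists>K. \<forall>j. cmod (a j) \<le> K"
proof -
  define \<phi> where "\<phi> N x = cmod (\<Sum>j<N. a j * x j)" for N :: nat and x
  have unit: "\<phi> N (unit_seq j) = (if j < N then cmod (a j) else 0)" for N j
  proof -
    have "(\<Sum>i<N. a i * unit_seq j i) = (\<Sum>i<N. if i = j then a i else 0)"
      by (intro sum.cong) (auto simp: unit_seq_def)
    then show ?thesis by (simp add: \<phi>_def)
  qed
  have "\<exists>C. \<forall>N j. \<phi> N (unit_seq j) \<le> C"
  proof (rule ell1_uniform_boundedness[where k = 1])
    fix N x y
    show "0 \<le> \<phi> N x" by (simp add: \<phi>_def)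
    show "\<phi> N (\<lambda>j. x j + y j) \<le> 2 powr (1 - 1) * (\<phi> N x + \<phi> N y)"
      by (simp add: \<phi>_def distrib_left sum.distrib norm_triangle_ineq)
    show "\<phi> N (\<lambda>j. c * x j) = cmod c powr 1 * \<phi> N x" for c
      by (simp add: \<phi>_def mult.left_commute flip: sum_distrib_left norm_mult)
    show "\<exists>S. \<forall>j. \<phi> N (unit_seq j) \<le> S"
      by (intro exI[of _ "\<Sum>j<N. cmod (a j)"]) (auto simp: unit sum_nonneg intro!: member_le_sum)
    assume x: "x \<in> ell1"
    then have sx: "summable (\<lambda>j. cmod (x j))" by (simp add: ell1_def)
    show "\<phi> N x \<le> S * (\<Sum>j. cmod (x j)) powr 1" if S: "\<And>j. \<phi> N (unit_seq j) \<le> S" for S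
    proof -
      \<comment> \<open>The functional \<open>\<phi> N\<close> vanishes at
        \<open>unit_seq N\<close>, the first coordinate outside the partial sum.\<close>
      have "0 \<le> S" using S[of N] by (simp add: unit)
      have "\<phi> N x \<le> (\<Sum>j<N. S * cmod (x j))"
        unfolding \<phi>_def
      proof (rule sum_norm_le)
        fix j assume "j \<in> {..<N}"
        then show "cmod (a j * x j) \<le> S * cmod (x j)"
          using S[of j] by (simp add: unit norm_mult mult_right_mono)
      qed
      also have "\<dots> \<le> S * (\<Sum>j. cmod (x j))"
        using \<open>0 \<le> S\<close> sx unfolding sum_distrib_left[symmetric]
        by (intro mult_left_mono sum_le_suminf) auto
      finally show ?thesis using sx by (simp add: suminf_nonneg)
    qed
    have "convergent (\<lambda>N. \<Sum>j<N. a j * x j)"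
      using assms[OF x] by (simp add: summable_iff_convergent)
    then have "Bseq (\<lambda>N. \<Sum>j<N. a j * x j)" by (rule convergent_imp_Bseq)
    then show "\<exists>C. \<forall>N. \<phi> N x \<le> C" unfolding \<phi>_def Bseq_def by blast
  qed simp
  then obtain C where "\<And>N j. \<phi> N (unit_seq j) \<le> C" by blast
  from this[of "Suc _"] have "cmod (a j) \<le> C" for j by (metis unit lessI)
  then show ?thesis by blast
qed

lemma riesz_b_rows_bounded:
  assumes "\<And>n. \<exists>K. \<forall>j. cmod (A n j) \<le> K"
  shows "\<exists>K. \<forall>j. cmod (riesz_b p A m n j) \<le> K"
proof -
  obtain K where K: "\<And>n j. cmod (A n j) \<le> K n" using assms by metis
  show ?thesis
  proof (cases "m = 0")
    case True
    then show ?thesis using assms by (simp add: riesz_b_def)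
  next
    case False
    define d where "d = complex_of_real (p m / (weight_sum p m * weight_sum p (m - 1)))"
    have "cmod (riesz_b p A m n j) \<le> cmod d * (\<Sum>v = 1..m. \<bar>weight_sum p (v - 1)\<bar> * K (n + v))" for j
      unfolding riesz_b_def d_def[symmetric] if_not_P[OF False] norm_mult
      by (intro mult_left_mono sum_norm_le) (auto simp: norm_mult intro!: mult_left_mono K)
    then show ?thesis by blast
  qed
qed

text \<open>Indexing the functionals by pairs \<open>(n, M)\<close> makes the bound uniform in both.
  Pointwise boundedness is \<open>almost_abs_riesz_partial_sums_bounded\<close> for
  \<open>A x\<close>, and at \<open>unit_seq j\<close> the functionals are the partial sums for
  column \<open>j\<close>.\<close>

lemma riesz_b_partial_sums_bounded:
  assumes p: "\<And>n. p n > 0" and u: "\<And>n. u n > 0" and k: "1 \<le> k"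
    and A: "A \<in> matrix_maps ell1 (almost_abs_riesz p u k)"
  shows "\<exists>C. \<forall>n j M. (\<Sum>m<M. u m powr (k - 1) * cmod (riesz_b p A m n j) powr k) \<le> C"
proof -
  have sA: "summable (\<lambda>j. A n j * x j)" and Ax: "(\<lambda>n. \<Sum>j. A n j * x j) \<in> almost_abs_riesz p u k"
    if "x \<in> ell1" for n x
    using A that unfolding matrix_maps_def by auto
  have "\<exists>K. \<forall>j. cmod (riesz_b p A m n j) \<le> K" for m n
    by (intro riesz_b_rows_bounded matrix_rows_bounded sA)
  then obtain K where K: "\<And>m n j. cmod (riesz_b p A m n j) \<le> K m n"
    by metis
  have sb: "summable (\<lambda>j. riesz_b p A m n j * x j)" if "x \<in> ell1" for m n x
    using summable_mult_bounded[where x = x and b = "riesz_b p A m n" and K = "K m n"] K that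
    by (intro summable_norm_cancel[of "\<lambda>j. riesz_b p A m n j * x j"]) (simp add: ell1_def)
  define w where "w m = u m powr (k - 1)" for m
  have w: "0 \<le> w m" for m by (simp add: w_def)
  \<comment> \<open>At this point the entries are bounded by \<open>K m n\<close> only for each
    \<open>m\<close> and \<open>n\<close> separately. Truncating at \<open>M\<close> leaves finitely
    many \<open>m\<close>, so each functional is bounded on the unit sequences.\<close>
  define \<phi> where "\<phi> = (\<lambda>(n, M) x. \<Sum>m<M. w m * cmod (\<Sum>j. riesz_b p A m n j * x j) powr k)"
  have unit: "\<phi> (n, M) (unit_seq j) = (\<Sum>m<M. w m * cmod (riesz_b p A m n j) powr k)" for n M j
    by (simp add: \<phi>_def suminf_mult_unit_seq)
  have "\<exists>C. \<forall>i j. \<phi> i (unit_seq j) \<le> C"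
  proof (rule ell1_uniform_boundedness[OF k])
    fix i :: "nat \<times> nat" and x y :: "nat \<Rightarrow> complex"
    obtain n M where i: "i = (n, M)" by (cases i)
    show "0 \<le> \<phi> i x" by (auto simp: \<phi>_def i w intro!: sum_nonneg)
    show "\<exists>S. \<forall>j. \<phi> i (unit_seq j) \<le> S"
      unfolding i unit
      using k w by (intro exI[of _ "\<Sum>m<M. w m * K m n powr k"] allI sum_mono mult_left_mono powr_mono2 K) auto
    assume x: "x \<in> ell1"
    then have sx: "summable (\<lambda>j. cmod (x j))" by (simp add: ell1_def)
    show "\<phi> i (\<lambda>j. c * x j) = cmod c powr k * \<phi> i x" for c
    proof -
      have "(\<Sum>j. riesz_b p A m n j * (c * x j)) = c * (\<Sum>j. riesz_b p A m n j * x j)" for m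
        using suminf_mult[OF sb[OF x], of c] by (simp add: mult.left_commute)
      then show ?thesis
        by (simp add: \<phi>_def i norm_mult powr_mult sum_distrib_left mult.left_commute)
    qed
    show "\<phi> i x \<le> S * (\<Sum>j. cmod (x j)) powr k" if S: "\<And>j. \<phi> i (unit_seq j) \<le> S" for S
    proof -
      define X where "X = (\<Sum>j. cmod (x j))"
      have X: "0 \<le> X" unfolding X_def using sx by (intro suminf_nonneg) auto
      have "\<phi> i x \<le> X powr (k - 1) *
          (\<Sum>j. cmod (x j) * (\<Sum>m<M. w m * cmod (riesz_b p A m n j) powr k))"
        unfolding \<phi>_def i prod.case X_def
        using k sx K w by (rule sum_norm_suminf_mult_powr_le)
      also have "\<dots> = X powr (k - 1) * (\<Sum>j. cmod (x j) * \<phi> i (unit_seq j))"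
        by (simp add: i unit)
      also have "(\<Sum>j. cmod (x j) * \<phi> i (unit_seq j)) \<le> (\<Sum>j. cmod (x j) * S)"
      proof (rule suminf_le)
        show "summable (\<lambda>j. cmod (x j) * \<phi> i (unit_seq j))"
          by (rule summable_mult_bounded_real[OF sx _ S]) (auto simp: unit i w intro!: sum_nonneg)
      qed (use sx S in \<open>auto intro: mult_left_mono summable_mult2\<close>)
      also have "\<dots> = X * S" unfolding X_def using sx by (rule suminf_mult2[symmetric])
      also have "X powr (k - 1) * (X * S) = S * X powr k"
        using X by (cases "X = 0") (simp_all add: powr_diff)
      finally show ?thesis by (simp add: X_def mult_left_mono)
    qed
    show "\<exists>C. \<forall>i. \<phi> i x \<le> C"
      using almost_abs_riesz_partial_sums_bounded[OF p u k Ax[OF x]]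
      by (simp add: \<phi>_def w_def sums_unique[OF riesz_F_suminf[OF sA[OF x]], symmetric])
    assume y: "y \<in> ell1"
    show "\<phi> i (\<lambda>j. x j + y j) \<le> 2 powr (k - 1) * (\<phi> i x + \<phi> i y)"
    proof -
      have "(\<Sum>j. riesz_b p A m n j * (x j + y j))
          = (\<Sum>j. riesz_b p A m n j * x j) + (\<Sum>j. riesz_b p A m n j * y j)" for m
        using suminf_add[OF sb[OF x] sb[OF y]] by (simp add: distrib_left)
      then have "\<phi> i (\<lambda>j. x j + y j) \<le> (\<Sum>m<M. w m * (2 powr (k - 1) *
          (cmod (\<Sum>j. riesz_b p A m n j * x j) powr k + cmod (\<Sum>j. riesz_b p A m n j * y j) powr k)))"
        using k w by (simp add: \<phi>_def i sum_mono mult_left_mono norm_add_powr_le)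
      also have "\<dots> = 2 powr (k - 1) * (\<phi> i x + \<phi> i y)"
        by (simp add: \<phi>_def i sum_distrib_left distrib_left sum.distrib mult.left_commute)
      finally show ?thesis .
    qed
  qed
  then show ?thesis by (fastforce simp: unit w_def)
qed

text \<open>The image of \<open>unit_seq j\<close> is column \<open>j\<close> of \<open>A\<close>,
  and \<open>riesz_b p A m n j\<close> is \<open>riesz_F p m n\<close> of that column.\<close>

lemma matrix_maps_ell1_columns:
  assumes "A \<in> matrix_maps ell1 (almost_abs_riesz p u k)"
  shows "series_converges_uniformly (\<lambda>m n. u m powr (k - 1) * cmod (riesz_b p A m n j) powr k)"
proof -
  have "(\<lambda>n. A n j) \<in> almost_abs_riesz p u k"
    using assms unit_seq_in_ell1[of j] unfolding matrix_maps_def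
    by (fastforce simp: suminf_mult_unit_seq)
  then show ?thesis
    by (simp add: almost_abs_riesz_def riesz_F_def riesz_b_def)
qed

section \<open>Sufficiency of the two conditions\<close>

lemma matrix_maps_ell1I:
  assumes u: "\<And>n. u n > 0" and k: "1 \<le> k"
    and conv: "\<And>j. series_converges_uniformly
           (\<lambda>m n. u m powr (k - 1) * cmod (riesz_b p A m n j) powr k)"
    and C: "\<And>n j M. (\<Sum>m<M. u m powr (k - 1) * cmod (riesz_b p A m n j) powr k) \<le> C"
  shows "A \<in> matrix_maps ell1 (almost_abs_riesz p u k)"
proof -
  define w where "w m = u m powr (k - 1)" for m
  have w: "0 < w m" for m using u[of m] by (simp add: w_def)
  define c where "c m n j = w m * cmod (riesz_b p A m n j) powr k" for m n j
  have c0: "0 \<le> c m n j" for m n j using less_imp_le[OF w] by (simp add: c_def)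
  have sc: "summable (\<lambda>m. c m n j)" for n j
    using conv[of j] by (simp add: series_converges_uniformly_def c_def w_def)
  have lim: "uniform_limit UNIV (\<lambda>M n. \<Sum>m. c (m + M) n j) (\<lambda>n. 0) sequentially" for j
    using conv[of j] by (simp add: series_converges_uniformly_def c_def w_def)
  have C0: "0 \<le> C" using C[where M = 0] by simp
  have Cc: "(\<Sum>m<M. c m n j) \<le> C" for n j M
    using C by (simp add: c_def w_def)
  define T where "T M n j = (\<Sum>m. c (m + M) n j)" for M n j
  have T0: "0 \<le> T M n j" for M n j
    unfolding T_def using summable_ignore_initial_segment[OF sc] c0 by (rule suminf_nonneg)
  have TC: "T M n j \<le> C" for M n j
  proof -
    have "T M n j + (\<Sum>m<M. c m n j) = (\<Sum>m. c m n j)"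
      unfolding T_def using sc by (rule suminf_split_initial_segment[symmetric])
    also have "\<dots> \<le> C" using sc Cc by (rule suminf_le_const)
    finally show ?thesis using sum_nonneg[of "{..<M}" "\<lambda>m. c m n j"] c0 by fastforce
  qed
  \<comment> \<open>A single term is at most the bound \<open>C\<close> on partial sums, which
    bounds the entries uniformly in \<open>n\<close> and \<open>j\<close>. For \<open>m = 0\<close>
    these are the entries of \<open>A\<close>, so \<open>A x\<close> is defined.\<close>
  define K where "K m = (C / w m) powr (1 / k)" for m
  have K: "cmod (riesz_b p A m n j) \<le> K m" for m n j
  proof -
    have "c m n j \<le> (\<Sum>m<Suc m. c m n j)"
      using c0 by (intro member_le_sum) auto
    then have "c m n j \<le> C" using Cc[of n j "Suc m"] by linarith
    then have "cmod (riesz_b p A m n j) powr k \<le> C / w m"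
      using w[of m] by (simp add: c_def field_simps)
    then show ?thesis unfolding K_def using k by (intro powr_le_imp_le_powr_inverse) auto
  qed
  show ?thesis
    unfolding matrix_maps_def mem_Collect_eq
  proof (intro ballI conjI allI)
    fix x assume "x \<in> ell1"
    then have sx: "summable (\<lambda>j. cmod (x j))" by (simp add: ell1_def)
    have "cmod (A n j) \<le> K 0" for n j using K[of 0 n j] by (simp add: riesz_b_def)
    then show sA: "summable (\<lambda>j. A n j * x j)" for n
      using sx by (intro summable_norm_cancel[OF summable_mult_bounded])
    define F where "F m n = riesz_F p m n (\<lambda>n. \<Sum>j. A n j * x j)" for m n
    have F: "F m n = (\<Sum>j. riesz_b p A m n j * x j)" for m n
      unfolding F_def by (rule sums_unique[OF riesz_F_suminf[OF sA]])
    define X where "X = (\<Sum>j. cmod (x j))"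
    have X: "0 \<le> X" unfolding X_def using sx by (intro suminf_nonneg) auto
    define W where "W = X powr (k - 1)"
    have W: "0 \<le> W" by (simp add: W_def)
    have sT: "summable (\<lambda>j. cmod (x j) * T M n j)" for M n
      using sx T0 TC by (rule summable_mult_bounded_real)
    \<comment> \<open>The estimate holds for every shift \<open>M\<close>: it yields summability, at
      \<open>M = 0\<close> that of the whole series, and the bound \<open>tail\<close>.\<close>
    have part: "(\<Sum>m<N. w (m + M) * cmod (F (m + M) n) powr k) \<le> W * (\<Sum>j. cmod (x j) * T M n j)"
      for N M n
    proof -
      have le: "(\<Sum>m<N. c (m + M) n j) \<le> T M n j" for j
        unfolding T_def using summable_ignore_initial_segment[OF sc] c0 by (intro sum_le_suminf) auto
      have "(\<Sum>m<N. w (m + M) * cmod (F (m + M) n) powr k)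
          \<le> W * (\<Sum>j. cmod (x j) * (\<Sum>m<N. c (m + M) n j))"
        unfolding F W_def X_def c_def using k sx K less_imp_le[OF w]
        by (rule sum_norm_suminf_mult_powr_le)
      also have "\<dots> \<le> W * (\<Sum>j. cmod (x j) * T M n j)"
      proof (intro mult_left_mono[OF suminf_le] W sT)
        show "summable (\<lambda>j. cmod (x j) * (\<Sum>m<N. c (m + M) n j))"
          using sx by (rule summable_mult_bounded_real[where K = C])
            (auto intro!: sum_nonneg c0 order_trans[OF le TC])
      qed (auto intro: mult_left_mono le)
      finally show ?thesis .
    qed
    have sF: "summable (\<lambda>m. w (m + M) * cmod (F (m + M) n) powr k)" for M n
      by (rule bounded_imp_summable[where B = "W * (\<Sum>j. cmod (x j) * T M n j)"])
        (use part[of M _ "Suc _"] less_imp_le[OF w] in \<open>auto simp: lessThan_Suc_atMost\<close>)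
    have tail: "(\<Sum>m. w (m + M) * cmod (F (m + M) n) powr k) \<le> W * (\<Sum>j. cmod (x j) * T M n j)" for M n
      using sF part by (rule suminf_le_const)
    have "uniform_limit UNIV (\<lambda>M n. \<Sum>m. w (m + M) * cmod (F (m + M) n) powr k) (\<lambda>n. 0) sequentially"
    proof (rule uniform_limitI)
      fix e :: real assume e: "0 < e"
      \<comment> \<open>The added ones keep the denominator positive when \<open>W\<close>,
        \<open>X\<close> or \<open>C\<close> is 0, and make the final inequality strict.\<close>
      define \<delta> where "\<delta> = e / ((W + 1) * (X + C + 1))"
      have \<delta>: "0 < \<delta>" using e W X C0 by (simp add: \<delta>_def)
      have "W * (X * \<delta> + C * \<delta>) = W * (X + C) * \<delta>"
        by (simp add: algebra_simps)
      also have "\<dots> < (W + 1) * (X + C + 1) * \<delta>"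
        using W X C0 \<delta> by (intro mult_strict_right_mono mult_strict_mono) auto
      also have "\<dots> = e"
        using W X C0 by (simp add: \<delta>_def)
      finally have small: "W * (X * \<delta> + C * \<delta>) < e" .
      \<comment> \<open>\<open>J\<close> depends only on \<open>x\<close> and
        \<open>\<delta>\<close>. With it fixed, only finitely many columns must have uniformly small
        tails, so one \<open>M\<close> serves them all.\<close>
      obtain J where J: "(\<Sum>j. cmod (x (j + J))) < \<delta>"
        using suminf_exist_split[OF \<delta> sx] by (auto simp: abs_less_iff)
      have "\<forall>\<^sub>F M in sequentially. \<forall>j\<in>{..<J}. \<forall>n\<in>UNIV. dist (T M n j) 0 < \<delta>"
        unfolding T_def using \<delta> by (intro eventually_ball_finite ballI uniform_limitD[OF lim]) auto
      then show "\<forall>\<^sub>F M in sequentially. \<forall>n\<in>UNIV.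
          dist (\<Sum>m. w (m + M) * cmod (F (m + M) n) powr k) 0 < e"
      proof eventually_elim
        case (elim M)
        have "dist (\<Sum>m. w (m + M) * cmod (F (m + M) n) powr k) 0 < e" for n
        proof -
          \<comment> \<open>Below \<open>J\<close> the column tails are less than
            \<open>\<delta>\<close> and the weights sum to at most \<open>X\<close>. From
            \<open>J\<close> on the column tails are at most \<open>C\<close> and the weights sum to
            less than \<open>\<delta>\<close>.\<close>
          have "(\<Sum>j. cmod (x j) * T M n j)
              = (\<Sum>j. cmod (x (j + J)) * T M n (j + J)) + (\<Sum>j<J. cmod (x j) * T M n j)"
            using sT by (rule suminf_split_initial_segment)
          also have "(\<Sum>j<J. cmod (x j) * T M n j) \<le> (\<Sum>j<J. cmod (x j) * \<delta>)"
            using elim T0 by (intro sum_mono mult_left_mono) (auto simp: dist_real_def less_imp_le)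
          also have "\<dots> \<le> X * \<delta>"
            unfolding sum_distrib_right[symmetric] X_def using \<delta> sx
            by (intro mult_right_mono sum_le_suminf) auto
          also have "(\<Sum>j. cmod (x (j + J)) * T M n (j + J)) \<le> (\<Sum>j. cmod (x (j + J)) * C)"
            using sx sT by (intro suminf_le mult_left_mono TC)
              (auto simp: summable_iff_shift[of "\<lambda>j. cmod (x j) * T M n j"]
                summable_iff_shift[of "\<lambda>j. cmod (x j)"] intro!: summable_mult2)
          also have "\<dots> = (\<Sum>j. cmod (x (j + J))) * C"
            using sx by (intro suminf_mult2[symmetric]) (simp add: summable_iff_shift[of "\<lambda>j. cmod (x j)"])
          also have "\<dots> \<le> \<delta> * C" using J C0 by (intro mult_right_mono) auto
          finally have "W * (\<Sum>j. cmod (x j) * T M n j) \<le> W * (X * \<delta> + C * \<delta>)"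
            using W by (intro mult_left_mono) (auto simp: mult.commute)
          with tail[of M n] small
          have "(\<Sum>m. w (m + M) * cmod (F (m + M) n) powr k) < e" by linarith
          moreover have "0 \<le> (\<Sum>m. w (m + M) * cmod (F (m + M) n) powr k)"
            using sF less_imp_le[OF w] by (intro suminf_nonneg) auto
          ultimately show ?thesis by (simp add: dist_real_def)
        qed
        then show ?case by blast
      qed
    qed
    moreover have "summable (\<lambda>m. w m * cmod (F m n) powr k)" for n
      using sF[of 0 n] by simp
    ultimately show "(\<lambda>n. \<Sum>j. A n j * x j) \<in> almost_abs_riesz p u k"
      by (simp add: almost_abs_riesz_def series_converges_uniformly_def F_def w_def)
  qed
qed

section \<open>The supremum condition in terms of real partial sums, and the equivalence\<close>

text \<open>In \<open>ennreal\<close> a divergent series has the value infinity, so finiteness of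
  the supremum includes convergence of each series. With nonnegative terms this amounts to a common
  bound on the real partial sums, the form used on both sides of the proof.\<close>

lemma SUP_suminf_ennreal_finite_iff:
  fixes c :: "'i \<Rightarrow> nat \<Rightarrow> real"
  assumes c: "\<And>i m. 0 \<le> c i m"
  shows "(SUP i. \<Sum>m. ennreal (c i m)) < \<infinity> \<longleftrightarrow> (\<exists>C. \<forall>i M. (\<Sum>m<M. c i m) \<le> C)"
proof
  assume fin: "(SUP i. \<Sum>m. ennreal (c i m)) < \<infinity>"
  define C where "C = enn2real (SUP i. \<Sum>m. ennreal (c i m))"
  have "(\<Sum>m<M. c i m) \<le> C" for i M
  proof -
    have "ennreal (\<Sum>m<M. c i m) = (\<Sum>m<M. ennreal (c i m))"
      using c by (simp add: sum_ennreal)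
    also have "\<dots> \<le> (\<Sum>m. ennreal (c i m))" by (intro sum_le_suminf) auto
    also have "\<dots> \<le> (SUP i. \<Sum>m. ennreal (c i m))" by (rule SUP_upper) simp
    also have "\<dots> = ennreal C" unfolding C_def using fin by simp
    finally show ?thesis by (simp add: C_def)
  qed
  then show "\<exists>C. \<forall>i M. (\<Sum>m<M. c i m) \<le> C" by blast
next
  assume "\<exists>C. \<forall>i M. (\<Sum>m<M. c i m) \<le> C"
  then obtain C where C: "\<And>i M. (\<Sum>m<M. c i m) \<le> C" by blast
  have "(SUP i. \<Sum>m. ennreal (c i m)) \<le> ennreal C"
    using c C by (intro SUP_least suminf_le_const) (auto simp: sum_ennreal ennreal_leI)
  then show "(SUP i. \<Sum>m. ennreal (c i m)) < \<infinity>"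
    by (simp add: le_less_trans)
qed

theorem theorem3p2:
  fixes p u :: "nat \<Rightarrow> real" and A :: "nat \<Rightarrow> nat \<Rightarrow> complex" and k :: real
  assumes "\<And>n. p n > 0"
    and "filterlim (weight_sum p) at_top sequentially"
    and "\<And>n. u n > 0"
    and "1 \<le> k"
  shows "A \<in> matrix_maps ell1 (almost_abs_riesz p u k) \<longleftrightarrow>
    (\<forall>j. series_converges_uniformly
           (\<lambda>m n. u m powr (k - 1) * cmod (riesz_b p A m n j) powr k)) \<and>
    (SUP (n, j) \<in> UNIV. \<Sum>m. ennreal (u m powr (k - 1) * cmod (riesz_b p A m n j) powr k)) < \<infinity>"
proof -
  have "(SUP (n, j) \<in> UNIV. \<Sum>m. ennreal (u m powr (k - 1) * cmod (riesz_b p A m n j) powr k)) < \<infinity>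
    \<longleftrightarrow> (\<exists>C. \<forall>n j M. (\<Sum>m<M. u m powr (k - 1) * cmod (riesz_b p A m n j) powr k) \<le> C)"
    unfolding case_prod_unfold by (subst SUP_suminf_ennreal_finite_iff) auto
  then show ?thesis
    using matrix_maps_ell1_columns[where A = A and p = p and u = u and k = k] matrix_maps_ell1I[where p = p and u = u and A = A, OF assms(3,4)]
      riesz_b_partial_sums_bounded[where p = p and u = u and A = A, OF assms(1,3,4)]
    by blast
qed

end
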